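(* Let $d\ge2$. For any $\ell,\ell'\in\mathbb{N}_0$, $k\in\mathcal{I}^d_\ell$ and $k'\in\mathcal{I}^d_{\ell'}$, $$\int_{\mathbb{S}^d_+}B^d_{\ell,k}(\mathbf{x})\,B^d_{\ell',k'}(\mathbf{x})\,d\omega_d(\mathbf{x})=\delta_{\ell\ell'}\,\delta_{kk'}.$$
   Context: $\mathbb{N}_0=\{0,1,2,\ldots\}$. $\mathbb{S}^d=\{\mathbf{x}\in\mathbb{R}^{d+1}:\|\mathbf{x}\|=1\}$ with surface measure $\omega_d$; $\mathbb{S}^d_+=\{\mathbf{x}\in\mathbb{S}^d:x_{d+1}\ge0\}$. Index set: $\mathcal{I}^d_\ell=\{k=(k_1,\ldots,k_{d-1})\in\mathbb{N}_0\times\cdots\times\mathbb{N}_0\times\mathbb{Z}: |k_{d-1}|\le k_{d-2}\le\cdots\le k_1\le\ell\}$ (for $d=2$: $k=k_1\in\mathbb{Z}$ with $|k_1|\le\ell$). One-variable polynomials: for $i\in\mathbb{N}_0$ let $\lambda_i=i+\frac{d-2}{2}$ and $f_{r,i}=\int_0^1x^r(1-x^2)^{\lambda_i}dx$, $r\in\mathbb{N}_0$. Let $p_{0,i}=1$, and for $j>0$ let $p_{j,i}(x)=\frac{1}{\Delta^i_{j-1}}\det M_{j,i}(x)$, where $M_{j,i}(x)$ is the $(j+1)\times(j+1)$ matrix whose row number $a$ ($a=0,\ldots,j-1$) is $(f_{a,i},f_{a+1,i},\ldots,f_{a+j,i})$ and whose last row is $(1,x,\ldots,x^j)$, and $\Delta^i_{j-1}=\det(f_{a+b,i})_{a,b=0}^{j-1}$.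 Put $\Psi_{j,i}(x)=p_{j,i}(x)\big/\big(\int_0^1p_{j,i}(u)^2(1-u^2)^{\lambda_i}du\big)^{1/2}$ for $x\in[0,1]$. Spherical harmonics: $\{Y^{d-1}_k\}$ is the real orthonormal system of spherical harmonics on $\mathbb{S}^{d-1}$ indexed by $k=(k_1,\ldots,k_{d-1})\in\bigcup_\ell\mathcal{I}_\ell^d$, with $Y_k^{d-1}$ of degree $|k_1|$ and $\int_{\mathbb{S}^{d-1}}Y^{d-1}_kY^{d-1}_{k'}d\omega_{d-1}=\delta_{kk'}$. For $\ell\in\mathbb{N}_0$, $k\in\mathcal{I}^d_\ell$ and $\mathbf{x}=(\bar{\mathbf{x}}\sin\theta,\cos\theta)\in\mathbb{S}^d_+$ with $\bar{\mathbf{x}}\in\mathbb{S}^{d-1}$, $\theta\in[0,\frac{\pi}{2}]$, $$B^d_{\ell,k}(\mathbf{x})=(\sin\theta)^{|k_1|}\,\Psi_{\ell-|k_1|,|k_1|}(\cos\theta)\,Y^{d-1}_k(\bar{\mathbf{x}}).$$ (For $d\ge3$, $|k_1|=k_1$.) *)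

theory Defs
  imports "HOL-Analysis.Analysis" "Jordan_Normal_Form.Determinant"
begin

(* R^d is real^'d with d = CARD('d), and R^(d+1) is (real^'d) \<times> real with its
   Euclidean product norm, so x_(d+1) is snd x. *)

definition hemisphere :: "((real^'d) \<times> real) set" where
  "hemisphere = {x \<in> sphere 0 1. 0 \<le> snd x}"

(* Surface measure on the unit sphere of an n-dimensional Euclidean space:
   a Borel set A of the sphere has measure n times the Lebesgue measure of the cone
   {t a. 0 < t \<le> 1, a \<in> A}; recall that sgn x = x / norm x. *)
definition surface_measure :: "'a::euclidean_space measure" where
  "surface_measure = scale_measure (of_nat DIM('a))
     (distr (restrict_space lborel (cball 0 1 - {0})) (restrict_space borel (sphere 0 1)) sgn)"

(* k = (k_1, ..., k_(d-1)) is a list, so k_(i+1) is k ! i and k_1 is hd k.  The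
   condition on k_1 has an absolute value because for d = 2 the entry k_1 may be negative. *)
definition index_set :: "nat \<Rightarrow> nat \<Rightarrow> int list set" where
  "index_set d l = {k. length k = d - 1 \<and> (\<forall>i < d - 2. 0 \<le> k ! i)
     \<and> (\<forall>i < d - 2. \<bar>k ! (i + 1)\<bar> \<le> k ! i) \<and> \<bar>hd k\<bar> \<le> int l}"

definition index_degree :: "int list \<Rightarrow> nat" where
  "index_degree k = nat \<bar>hd k\<bar>"

definition lam :: "nat \<Rightarrow> nat \<Rightarrow> real" where
  "lam d i = real i + (real d - 2) / 2"

definition moment :: "nat \<Rightarrow> nat \<Rightarrow> nat \<Rightarrow> real" where
  "moment d r i = (LBINT x:{0..1}. x ^ r * (1 - x\<^sup>2) powr lam d i)"

definition M_matrix :: "nat \<Rightarrow> nat \<Rightarrow> nat \<Rightarrow> real \<Rightarrow> real mat" where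
  "M_matrix d j i x = Matrix.mat (j + 1) (j + 1)
     (\<lambda>(a, b). if a < j then moment d (a + b) i else x ^ b)"

(* hankel_det d m i is the determinant of the matrix (f_(a+b,i)) with 0 \<le> a, b < m;
   the paper's Delta^i_(j-1), with 0 \<le> a, b \<le> j - 1, is hankel_det d j i. *)
definition hankel_det :: "nat \<Rightarrow> nat \<Rightarrow> nat \<Rightarrow> real" where
  "hankel_det d m i = Determinant.det (Matrix.mat m m (\<lambda>(a, b). moment d (a + b) i))"

definition p_poly :: "nat \<Rightarrow> nat \<Rightarrow> nat \<Rightarrow> real \<Rightarrow> real" where
  "p_poly d j i x =
     (if j = 0 then 1 else 1 / hankel_det d j i * Determinant.det (M_matrix d j i x))"

definition Psi :: "nat \<Rightarrow> nat \<Rightarrow> nat \<Rightarrow> real \<Rightarrow> real" where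
  "Psi d j i x =
     p_poly d j i x / sqrt (LBINT u:{0..1}. (p_poly d j i u)\<^sup>2 * (1 - u\<^sup>2) powr lam d i)"

definition laplacian :: "('a::euclidean_space \<Rightarrow> real) \<Rightarrow> 'a \<Rightarrow> real" where
  "laplacian f x = (\<Sum>b\<in>Basis. (deriv ^^ 2) (\<lambda>t. f (x + t *\<^sub>R b)) 0)"

definition spherical_harmonic :: "nat \<Rightarrow> ('a::euclidean_space \<Rightarrow> real) \<Rightarrow> bool" where
  "spherical_harmonic n f \<longleftrightarrow>
     (\<exists>P. real_polynomial_function P \<and> (\<forall>c x. P (c *\<^sub>R x) = c ^ n * P x)
        \<and> (\<forall>x. laplacian P x = 0) \<and> (\<forall>x \<in> sphere 0 1. f x = P x))"

definition spherical_harmonic_system :: "(int list \<Rightarrow> real^'d \<Rightarrow> real) \<Rightarrow> bool" where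
  "spherical_harmonic_system Y \<longleftrightarrow>
     (\<forall>k \<in> (\<Union>l. index_set CARD('d) l). spherical_harmonic (index_degree k) (Y k)) \<and>
     (\<forall>k \<in> (\<Union>l. index_set CARD('d) l). \<forall>k' \<in> (\<Union>l. index_set CARD('d) l).
        (LINT x|surface_measure. Y k x * Y k' x) = (if k = k' then 1 else 0))"

(* At the pole (0, 1) the point u is arbitrary; there sin \<theta> = 0 and harmonics of degree 0
   are constant, so the choice is immaterial (see B_fun_polar). *)
definition B_fun :: "(int list \<Rightarrow> real^'d \<Rightarrow> real) \<Rightarrow> nat \<Rightarrow> int list \<Rightarrow> (real^'d) \<times> real \<Rightarrow> real" where
  "B_fun Y l k x =
     (let \<theta> = arccos (snd x); u = (SOME u. u \<in> sphere 0 1 \<and> fst x = sin \<theta> *\<^sub>R u)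
      in sin \<theta> ^ index_degree k
         * Psi CARD('d) (l - index_degree k) (index_degree k) (cos \<theta>) * Y k u)"

lemma B_fun_polar:
  fixes Y :: "int list \<Rightarrow> real^'d \<Rightarrow> real"
  assumes Y: "spherical_harmonic_system Y" and k: "k \<in> index_set CARD('d) l"
    and u: "u \<in> sphere 0 1" and \<theta>: "\<theta> \<in> {0..pi/2}"
  shows "B_fun Y l k (sin \<theta> *\<^sub>R u, cos \<theta>) =
    sin \<theta> ^ index_degree k
      * Psi CARD('d) (l - index_degree k) (index_degree k) (cos \<theta>) * Y k u"
proof -
  have ac: "arccos (cos \<theta>) = \<theta>"
    using \<theta> by (intro arccos_cos) auto
  define v where "v = (SOME v. v \<in> sphere 0 1 \<and> sin \<theta> *\<^sub>R u = sin \<theta> *\<^sub>R v)"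
  have v: "v \<in> sphere 0 1 \<and> sin \<theta> *\<^sub>R u = sin \<theta> *\<^sub>R v"
    unfolding v_def by (rule someI[of _ u]) (use u in auto)
  have "spherical_harmonic (index_degree k) (Y k)"
    using Y k unfolding spherical_harmonic_system_def by blast
  then obtain P where P: "\<And>c x. P (c *\<^sub>R x) = c ^ index_degree k * P x"
    "\<And>x. x \<in> sphere 0 1 \<Longrightarrow> Y k x = P x"
    unfolding spherical_harmonic_def by blast
  have "sin \<theta> ^ index_degree k * Y k v = sin \<theta> ^ index_degree k * Y k u"
    using P(1)[of "sin \<theta>" u] P(1)[of "sin \<theta>" v] P(2)[of u] P(2)[of v] u v by metis
  then show ?thesis
    unfolding B_fun_def Let_def fst_conv snd_conv ac v_def[symmetric]
    by auto
qed

lemma emeasure_surface_measure: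
  fixes A :: "'a::euclidean_space set"
  assumes A: "A \<in> sets borel" "A \<subseteq> sphere 0 1"
  shows "emeasure surface_measure A =
    of_nat DIM('a) * emeasure lborel {t *\<^sub>R a |t a. 0 < t \<and> t \<le> 1 \<and> a \<in> A}"
proof -
  have sp: "space (restrict_space lborel (cball (0::'a) 1 - {0})) = cball 0 1 - {0}"
    by (simp add: space_restrict_space)
  have m: "sgn \<in> measurable (restrict_space lborel (cball (0::'a) 1 - {0}))
      (restrict_space borel (sphere 0 1))"
    by (intro measurable_restrict_space3[where f = sgn] measurable_restrict_space2)
      (auto simp: sgn_div_norm)
  have S: "A \<in> sets (restrict_space borel (sphere 0 1))"
    using A by (auto simp: sets_restrict_space_iff)
  have eq: "sgn -` A \<inter> (cball 0 1 - {0}) = {t *\<^sub>R a |t a. 0 < t \<and> t \<le> 1 \<and> a \<in> A}"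
    (is "?L = ?R")
  proof (intro Set.set_eqI iffI)
    fix x assume "x \<in> ?L"
    then have "x = norm x *\<^sub>R sgn x \<and> 0 < norm x \<and> norm x \<le> 1 \<and> sgn x \<in> A"
      by (auto simp: sgn_div_norm)
    then show "x \<in> ?R" by blast
  next
    fix x assume "x \<in> ?R"
    then obtain t a where "x = t *\<^sub>R a" "0 < t" "t \<le> 1" "a \<in> A" by blast
    moreover from this A(2) have "norm a = 1" by auto
    ultimately show "x \<in> ?L" by (auto simp: sgn_div_norm)
  qed
  show ?thesis
    unfolding surface_measure_def
    by (simp add: emeasure_distr[OF m S] sp eq) (subst emeasure_restrict_space; auto simp flip: eq)
qed

end

theory Submission imports Defs begin

text \<open>
  The integral over the hemisphere separates. In the coordinates longitude \<open>u\<close> (a point of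
  the unit sphere of \<open>\<real>\<^sup>d\<close>) and height \<open>s \<in> [0,1]\<close> the surface measure of the upper half of
  the unit sphere of \<open>\<real>\<^sup>d \<times> \<real>\<close> is the product of the surface measure of the lower-dimensional
  sphere and the measure \<open>(1 - s\<^sup>2) powr ((d - 2) / 2) ds\<close> (lemma \<open>hemisphere_product_measure\<close>).
  A harmonic polynomial of degree \<open>i\<close>, evaluated at the horizontal part \<open>sqrt (1 - s\<^sup>2) *\<^sub>R u\<close>,
  splits off \<open>sqrt (1 - s\<^sup>2) ^ i\<close>. Hence the integral of a product of two basis functions is the
  integral of two spherical harmonics times a one-variable integral
  (\<open>hemisphere_integral_product\<close>). The first factor is \<open>1\<close> or \<open>0\<close> as \<open>k = k'\<close> or not. If
  \<open>k = k'\<close>, both harmonics have the same degree \<open>i\<close>, the powers combine with the density to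
  the weight \<open>(1 - s\<^sup>2) powr lam d i\<close>, and the second factor is the inner product of two of the
  normalised orthogonal polynomials for this weight (\<open>Psi_orthonormal\<close>), of degrees
  \<open>l - i\<close> and \<open>l' - i\<close>.

  The orthogonal polynomials are given by determinants of moments. Integrating such a
  determinant against a lower power of \<open>x\<close> produces two equal rows, hence zero; positivity of
  the weight makes the Hankel determinants and the norms nonzero.

  The product formula for the surface measure has to be derived from its definition by volumes of
  solid sectors. It is proved on product sets (\<open>emeasure_hemisphere_product_set\<close>)
  by Fubini, a one-dimensional substitution along each vertical line, and the scaling
  behaviour of volume.
\<close>

section \<open>The one-variable orthogonal polynomials\<close>

abbreviation weighted_integral :: "nat \<Rightarrow> nat \<Rightarrow> (real \<Rightarrow> real) \<Rightarrow> real" where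
  "weighted_integral d i f \<equiv> (LBINT x:{0..1}. f x * (1 - x\<^sup>2) powr lam d i)"

lemma weighted_integrable:
  assumes d: "2 \<le> d" and f: "continuous_on {0..1} f"
  shows "set_integrable lborel {0..1} (\<lambda>x. f x * (1 - x\<^sup>2) powr lam d i)"
proof (rule set_integrable_bound)
  show f_int: "set_integrable lborel {0..1} f"
    by (rule borel_integrable_atLeastAtMost'[OF f])
  have "(\<lambda>x. (indicator {0..1} x *\<^sub>R f x) * (1 - x\<^sup>2) powr lam d i) \<in> borel_measurable lborel"
    by (rule borel_measurable_times[OF borel_measurable_integrable[OF f_int[unfolded set_integrable_def]]])
       measurable
  then show "set_borel_measurable lborel {0..1} (\<lambda>x. f x * (1 - x\<^sup>2) powr lam d i)"
    by (simp add: set_borel_measurable_def mult.assoc)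
  have "(1 - x\<^sup>2) powr lam d i \<le> 1" if "x \<in> {0..1}" for x :: real
    using that d by (intro powr_le1) (auto simp: lam_def power_le_one)
  then show "AE x in lborel. x \<in> {0..1} \<longrightarrow> norm (f x * (1 - x\<^sup>2) powr lam d i) \<le> norm (f x)"
    by (intro AE_I2 impI) (simp add: abs_mult mult_left_le)
qed

lemma weighted_integral_sum:
  assumes d: "2 \<le> d" and f: "\<And>b. b \<in> B \<Longrightarrow> continuous_on {0..1} (f b)"
  shows "weighted_integral d i (\<lambda>x. \<Sum>b\<in>B. c b * f b x) = (\<Sum>b\<in>B. c b * weighted_integral d i (f b))"
proof -
  have int: "set_integrable lborel {0..1} (\<lambda>x. f b x * (1 - x\<^sup>2) powr lam d i)" if "b \<in> B" for b
    by (rule weighted_integrable[OF d f[OF that]])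
  have "weighted_integral d i (\<lambda>x. \<Sum>b\<in>B. c b * f b x)
      = (LBINT x. (\<Sum>b\<in>B. c b * (indicator {0..1} x *\<^sub>R (f b x * (1 - x\<^sup>2) powr lam d i))))"
    unfolding set_lebesgue_integral_def
    by (intro Bochner_Integration.integral_cong refl)
       (simp add: sum_distrib_left sum_distrib_right algebra_simps)
  also have "\<dots> = (\<Sum>b\<in>B. c b * weighted_integral d i (f b))"
    using int unfolding set_lebesgue_integral_def set_integrable_def
    by (subst Bochner_Integration.integral_sum) auto
  finally show ?thesis .
qed

text \<open>A nonnegative integrand with integral zero vanishes almost everywhere, but the weight is
  positive on \<open>[0,1)\<close> and a nonzero polynomial has only finitely many roots.\<close>

lemma weighted_integral_power2_pos:
  assumes d: "2 \<le> d" and q: "q \<noteq> 0"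
  shows "0 < weighted_integral d i (\<lambda>x. (poly q x)\<^sup>2)"
proof -
  let ?g = "\<lambda>x. indicator {0..1} x *\<^sub>R ((poly q x)\<^sup>2 * (1 - x\<^sup>2) powr lam d i)"
  have int: "integrable lborel ?g"
    using weighted_integrable[OF d, of "\<lambda>x. (poly q x)\<^sup>2" i]
    unfolding set_integrable_def by (simp add: continuous_intros)
  have nonneg: "0 \<le> ?g x" for x by (auto simp: indicator_def)
  have "integral\<^sup>L lborel ?g \<noteq> 0"
  proof
    assume "integral\<^sup>L lborel ?g = 0"
    then have "AE x in lborel. ?g x = 0"
      using integral_nonneg_eq_0_iff_AE[OF int] nonneg by auto
    moreover have "AE x in lborel. x \<notin> {x. poly q x = 0}"
      by (rule AE_not_in, rule finite_imp_null_set_lborel, rule poly_roots_finite[OF q])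
    moreover have "AE x in lborel. x \<noteq> (1::real)" by (rule AE_lborel_singleton)
    ultimately have "AE x in lborel. x \<notin> {0..1::real}"
    proof eventually_elim
      case (elim x)
      show ?case
      proof
        assume x: "x \<in> {0..1}"
        then have "x\<^sup>2 < 1" using elim(3) by (simp add: abs_square_less_1)
        then show False using elim x by auto
      qed
    qed
    then have "{0..1::real} \<in> null_sets lborel"
      by (subst AE_iff_null_sets) simp_all
    then show False by (simp add: null_sets_def)
  qed
  then show ?thesis
    using Bochner_Integration.integral_nonneg[of lborel ?g, OF nonneg]
    unfolding set_lebesgue_integral_def by linarith
qed

text \<open>If \<open>v\<close> is in the kernel of the Hankel matrix and \<open>q\<close> is the polynomial with
  coefficients \<open>v\<close>, then \<open>v\<^sup>T H v\<close> is the weighted integral of \<open>q\<^sup>2\<close>; it vanishes, so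
  \<open>q = 0\<close> and \<open>v = 0\<close>.\<close>

lemma hankel_det_nonzero:
  assumes d: "2 \<le> d"
  shows "hankel_det d m i \<noteq> 0"
proof
  let ?H = "Matrix.mat m m (\<lambda>(a, b). moment d (a + b) i)"
  assume "hankel_det d m i = 0"
  then obtain v where v: "v \<in> carrier_vec m" "v \<noteq> 0\<^sub>v m" "?H *\<^sub>v v = 0\<^sub>v m"
    unfolding hankel_det_def by (subst (asm) det_0_iff_vec_prod_zero[of _ m]) auto
  define q where "q = (\<Sum>b<m. monom (vec_index v b) b)"
  have poly_q: "poly q x = (\<Sum>b<m. vec_index v b * x ^ b)" for x
    by (simp add: q_def poly_sum poly_monom)
  have "q \<noteq> 0"
  proof
    assume "q = 0"
    have "vec_index v b = 0" if "b < m" for b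
    proof -
      have "poly.coeff q b = vec_index v b"
        using that by (simp add: q_def coeff_sum coeff_monom)
      then show ?thesis using \<open>q = 0\<close> by simp
    qed
    then have "v = 0\<^sub>v m" using v(1) by (intro eq_vecI) auto
    then show False using v(2) by simp
  qed
  have row: "(\<Sum>b<m. vec_index v b * moment d (a + b) i) = 0" if "a < m" for a
  proof -
    have "vec_index (?H *\<^sub>v v) a = (\<Sum>b<m. moment d (a + b) i * vec_index v b)"
      using that v(1) by (simp add: scalar_prod_def atLeast0LessThan)
    then show ?thesis using v(3) that by (simp add: mult.commute)
  qed
  have "weighted_integral d i (\<lambda>x. (poly q x)\<^sup>2)
      = weighted_integral d i (\<lambda>x. \<Sum>a<m. vec_index v a * (\<Sum>b<m. vec_index v b * x ^ (a + b)))"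
    by (intro set_lebesgue_integral_cong)
       (auto simp: poly_q power2_eq_square sum_product sum_distrib_left power_add algebra_simps)
  also have "\<dots> = (\<Sum>a<m. vec_index v a * weighted_integral d i (\<lambda>x. \<Sum>b<m. vec_index v b * x ^ (a + b)))"
    by (intro weighted_integral_sum[OF d] continuous_intros)
  also have "\<dots> = (\<Sum>a<m. vec_index v a * (\<Sum>b<m. vec_index v b * moment d (a + b) i))"
    unfolding moment_def
    by (intro sum.cong refl arg_cong2[of _ _ _ _ "(*)"] weighted_integral_sum[OF d] continuous_intros)
  also have "\<dots> = 0" by (simp add: row)
  finally show False using weighted_integral_power2_pos[OF d \<open>q \<noteq> 0\<close>, of i] by simp
qed

text \<open>Only the last row of the defining determinant depends on \<open>x\<close>, so its expansion along that
  row is a polynomial whose coefficients are cofactors built from moments. The top cofactor is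
  the Hankel determinant, which makes \<open>p\<close> monic of exact degree \<open>j\<close>. Integrating against
  \<open>x\<^sup>m\<close> replaces the last row by the moments of row \<open>m\<close>; for \<open>m < j\<close> two rows coincide.\<close>

lemma p_poly_orthogonal_polynomial:
  assumes d: "2 \<le> d"
  obtains p where "\<And>x. p_poly d j i x = poly p x" "degree p = j" "p \<noteq> 0"
    "\<And>m. m < j \<Longrightarrow> weighted_integral d i (\<lambda>x. x ^ m * p_poly d j i x) = 0"
proof -
  define h where "h = hankel_det d j i"
  have h: "h \<noteq> 0" unfolding h_def by (rule hankel_det_nonzero[OF d])
  \<comment> \<open>The matrix with a free last row \<open>r\<close>: powers of \<open>x\<close> give \<open>p\<close>, moments give its integrals.\<close>
  define R where "R r = Matrix.mat (j + 1) (j + 1)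
    (\<lambda>(a, b). if a < j then moment d (a + b) i else r b)" for r :: "nat \<Rightarrow> real"
  define c where "c b = Determinant.cofactor (R (\<lambda>_. 0)) j b" for b
  have R: "R r \<in> carrier_mat (j + 1) (j + 1)" for r by (simp add: R_def)
  have det_R: "Determinant.det (R r) = (\<Sum>b\<le>j. c b * r b)" for r
  proof -
    have "Determinant.cofactor (R r) j b = c b" if "b \<le> j" for b
    proof -
      have "mat_delete (R r) j b = mat_delete (R (\<lambda>_. 0)) j b"
        by (intro eq_matI) (auto simp: mat_delete_def R_def)
      then show ?thesis by (simp add: c_def Determinant.cofactor_def)
    qed
    moreover have "R r $$ (j, b) = r b" if "b \<le> j" for b
      using that by (simp add: R_def)
    ultimately show ?thesis
      using laplace_expansion_row[OF R, of j r] by (simp add: lessThan_Suc_atMost mult.commute)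
  qed
  have p_eq: "p_poly d j i x = 1 / h * (\<Sum>b\<le>j. c b * x ^ b)" for x
  \<comment> \<open>The case split in the definition of \<open>p\<close> is absorbed since the empty determinant is \<open>1\<close>.\<close>
  proof (cases "j = 0")
    case True
    have "c 0 = 1" "h = 1"
      by (simp_all add: True c_def h_def hankel_det_def Determinant.cofactor_def mat_delete_def
          det_dim_zero R_def)
    then show ?thesis by (simp add: p_poly_def True)
  next
    case False
    have "M_matrix d j i x = R (\<lambda>b. x ^ b)" by (simp add: M_matrix_def R_def)
    then show ?thesis using False by (simp add: p_poly_def det_R h_def)
  qed
  have c_top: "c j = h"
  proof -
    have "mat_delete (R (\<lambda>_. 0)) j j = Matrix.mat j j (\<lambda>(a, b). moment d (a + b) i)"
      by (intro eq_matI) (auto simp: mat_delete_def R_def)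
    then show ?thesis by (simp add: c_def h_def hankel_det_def Determinant.cofactor_def)
  qed
  define p where "p = Polynomial.smult (1 / h) (\<Sum>b\<le>j. monom (c b) b)"
  have coeff_p: "poly.coeff p b = (if b \<le> j then c b / h else 0)" for b
    by (simp add: p_def coeff_sum coeff_monom)
  have "degree p = j"
    by (rule antisym[OF degree_le le_degree]) (use h in \<open>auto simp: coeff_p c_top\<close>)
  moreover have "p \<noteq> 0"
    using coeff_p[of j] c_top h by auto
  moreover have "p_poly d j i x = poly p x" for x
    by (simp add: p_eq p_def poly_sum poly_monom)
  moreover have "weighted_integral d i (\<lambda>x. x ^ m * p_poly d j i x) = 0" if m: "m < j" for m
  proof -
    have "weighted_integral d i (\<lambda>x. x ^ m * p_poly d j i x)
        = weighted_integral d i (\<lambda>x. \<Sum>b\<le>j. (c b / h) * x ^ (m + b))"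
      by (intro set_lebesgue_integral_cong)
         (auto simp: p_eq sum_distrib_left power_add algebra_simps sum_divide_distrib)
    also have "\<dots> = (\<Sum>b\<le>j. (c b / h) * moment d (m + b) i)"
      unfolding moment_def by (intro weighted_integral_sum[OF d] continuous_intros)
    also have "\<dots> = Determinant.det (R (\<lambda>b. moment d (m + b) i)) / h"
      by (simp add: det_R sum_divide_distrib)
    also have "Determinant.det (R (\<lambda>b. moment d (m + b) i)) = 0"
      by (rule det_identical_rows[OF R, of m j]) (use m in \<open>auto simp: R_def\<close>)
    finally show ?thesis by simp
  qed
  ultimately show ?thesis by (intro that) auto
qed

text \<open>Expand the polynomial of smaller degree in powers of \<open>x\<close>, each orthogonal to the other one.\<close>

lemma p_poly_orthogonal:
  assumes d: "2 \<le> d" and "j \<noteq> j'"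
  shows "weighted_integral d i (\<lambda>x. p_poly d j i x * p_poly d j' i x) = 0"
  using \<open>j \<noteq> j'\<close>
proof (induction j j' rule: linorder_wlog)
  case (le j j')
  obtain p where p: "\<And>x. p_poly d j i x = poly p x" "degree p = j"
    using p_poly_orthogonal_polynomial[OF d] by metis
  obtain p' where p': "\<And>x. p_poly d j' i x = poly p' x"
    and orth: "\<And>m. m < j' \<Longrightarrow> weighted_integral d i (\<lambda>x. x ^ m * p_poly d j' i x) = 0"
    using p_poly_orthogonal_polynomial[OF d] by metis
  have "weighted_integral d i (\<lambda>x. p_poly d j i x * p_poly d j' i x)
      = weighted_integral d i (\<lambda>x. \<Sum>m\<le>j. poly.coeff p m * (x ^ m * p_poly d j' i x))"
    by (intro set_lebesgue_integral_cong)
       (auto simp: p poly_altdef sum_distrib_right sum_distrib_left mult.assoc)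
  also have "\<dots> = (\<Sum>m\<le>j. poly.coeff p m * weighted_integral d i (\<lambda>x. x ^ m * p_poly d j' i x))"
    by (intro weighted_integral_sum[OF d]) (auto simp: p' intro!: continuous_intros)
  also have "\<dots> = 0" using le by (intro sum.neutral) (auto simp: orth)
  finally show ?case .
next
  case (sym j j')
  then show ?case by (simp add: mult.commute)
qed

lemma continuous_Psi:
  assumes d: "2 \<le> d"
  shows "continuous_on A (Psi d j i)"
proof -
  obtain p where p: "\<And>x. p_poly d j i x = poly p x"
    using p_poly_orthogonal_polynomial[OF d] by metis
  then show ?thesis
    unfolding Psi_def divide_inverse by (auto simp: p intro!: continuous_intros)
qed

lemma Psi_orthonormal:
  assumes d: "2 \<le> d"
  shows "weighted_integral d i (\<lambda>x. Psi d j i x * Psi d j' i x) = (if j = j' then 1 else 0)"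
proof -
  define n where "n j = weighted_integral d i (\<lambda>x. (p_poly d j i x)\<^sup>2)" for j
  have "weighted_integral d i (\<lambda>x. Psi d j i x * Psi d j' i x)
      = weighted_integral d i (\<lambda>x. \<Sum>_\<in>{()}. 1 / (sqrt (n j) * sqrt (n j')) * (p_poly d j i x * p_poly d j' i x))"
    by (intro set_lebesgue_integral_cong) (auto simp: Psi_def n_def)
  also have "\<dots> = 1 / (sqrt (n j) * sqrt (n j'))
      * weighted_integral d i (\<lambda>x. p_poly d j i x * p_poly d j' i x)"
  proof (subst weighted_integral_sum[OF d])
    obtain p p' where "\<And>x. p_poly d j i x = poly p x" "\<And>x. p_poly d j' i x = poly p' x"
      using p_poly_orthogonal_polynomial[OF d] by metis
    then show "continuous_on {0..1} (\<lambda>x. p_poly d j i x * p_poly d j' i x)"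
      by (auto intro!: continuous_intros)
  qed simp
  also have "\<dots> = (if j = j' then 1 else 0)"
  proof (cases "j = j'")
    case True
    obtain p where p: "\<And>x. p_poly d j i x = poly p x" "p \<noteq> 0"
      using p_poly_orthogonal_polynomial[OF d] by metis
    then have "0 < n j"
      unfolding n_def p(1) by (intro weighted_integral_power2_pos[OF d])
    then show ?thesis using True by (simp add: n_def flip: power2_eq_square)
  next
    case False
    then show ?thesis using p_poly_orthogonal[OF d] by simp
  qed
  finally show ?thesis .
qed

section \<open>Surface measure and sectors of the ball\<close>

text \<open>Surface measure is, up to the factor \<open>DIM('a)\<close>, the volume of the solid sector over a set of
  directions. For \<open>A \<subseteq> sphere 0 1\<close> the origin is excluded automatically because
  \<open>sgn 0 = 0\<close>; using \<open>sgn x \<in> A\<close> instead of multiples \<open>t *\<^sub>R a\<close> makes measurability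
  immediate.\<close>

definition sector :: "'a::euclidean_space set \<Rightarrow> real \<Rightarrow> 'a set" where
  "sector A r = {x \<in> cball 0 r. sgn x \<in> A}"

lemma sector_borel [measurable]:
  assumes "A \<in> sets borel"
  shows "sector A r \<in> sets borel"
proof -
  have "sgn -` A \<inter> space borel \<in> sets (borel :: 'a::euclidean_space measure)"
    by (rule measurable_sets[OF borel_measurable_sgn assms])
  moreover have "sector A r = cball 0 r \<inter> (sgn -` A \<inter> space borel)"
    by (auto simp: sector_def)
  ultimately show ?thesis by (simp add: sets.Int)
qed

lemma sgn_in_sphere_iff: "sgn x \<in> sphere 0 1 \<longleftrightarrow> x \<noteq> (0::'a::real_normed_vector)"
  by (simp add: norm_sgn)

lemma emeasure_surface_measure_sector:
  fixes A :: "'a::euclidean_space set"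
  assumes A: "A \<in> sets borel" "A \<subseteq> sphere 0 1"
  shows "emeasure surface_measure A = of_nat DIM('a) * emeasure lborel (sector A 1)"
proof -
  have "{t *\<^sub>R a |t a. 0 < t \<and> t \<le> 1 \<and> a \<in> A} = sector A 1"
  proof (intro Set.set_eqI iffI)
    fix x assume "x \<in> {t *\<^sub>R a |t a. 0 < t \<and> t \<le> 1 \<and> a \<in> A}"
    then obtain t a where "x = t *\<^sub>R a" "0 < t" "t \<le> 1" "a \<in> A" by blast
    moreover from this A(2) have "norm a = 1" by auto
    ultimately show "x \<in> sector A 1" by (auto simp: sector_def sgn_div_norm)
  next
    fix x assume x: "x \<in> sector A 1"
    then have "x \<noteq> 0" using A(2) sgn_in_sphere_iff[of x] by (auto simp: sector_def)
    then have "x = norm x *\<^sub>R sgn x \<and> 0 < norm x \<and> norm x \<le> 1 \<and> sgn x \<in> A"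
      using x by (auto simp: sgn_div_norm sector_def)
    then show "x \<in> {t *\<^sub>R a |t a. 0 < t \<and> t \<le> 1 \<and> a \<in> A}" by blast
  qed
  then show ?thesis using emeasure_surface_measure[OF A] by simp
qed

lemma sets_surface_measure [measurable_cong]:
  "sets surface_measure = sets (restrict_space borel (sphere 0 1))"
  by (simp add: surface_measure_def)

lemma space_surface_measure [simp]: "space surface_measure = sphere 0 1"
  by (simp add: surface_measure_def space_scale_measure space_restrict_space)

lemma sets_surface_measure_iff:
  "A \<in> sets (surface_measure :: 'a::euclidean_space measure) \<longleftrightarrow> A \<in> sets borel \<and> A \<subseteq> sphere 0 1"
  by (subst sets_surface_measure, subst sets_restrict_space_iff) auto

lemma emeasure_sector_finite:
  fixes A :: "'a::euclidean_space set"
  shows "emeasure lborel (sector A r) < \<infinity>"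
proof -
  have "emeasure lborel (sector A r) \<le> emeasure lborel (cball (0::'a) r)"
    by (intro emeasure_mono) (auto simp: sector_def)
  also have "\<dots> < \<infinity>" by (rule emeasure_lborel_cball_finite)
  finally show ?thesis .
qed

lemma finite_measure_surface_measure: "finite_measure (surface_measure :: 'a::euclidean_space measure)"
proof
  show "emeasure (surface_measure :: 'a::euclidean_space measure) (space surface_measure) \<noteq> \<infinity>"
    using less_imp_neq[OF emeasure_sector_finite[of "sphere (0::'a) 1" 1]]
    by (simp add: emeasure_surface_measure_sector ennreal_mult_eq_top_iff)
qed

lemma nn_integral_lborel_scaleR:
  fixes f :: "'a::euclidean_space \<Rightarrow> ennreal"
  assumes [measurable]: "f \<in> borel_measurable borel" and c: "0 < c"
  shows "(\<integral>\<^sup>+x. f x \<partial>lborel) = ennreal (c ^ DIM('a)) * (\<integral>\<^sup>+x. f (c *\<^sub>R x) \<partial>lborel)"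
proof -
  have "(\<integral>\<^sup>+x. f x \<partial>lborel)
      = (\<integral>\<^sup>+x. f x \<partial>density (distr lborel borel (\<lambda>x. 0 + c *\<^sub>R x)) (\<lambda>_. ennreal (\<bar>c\<bar> ^ DIM('a))))"
    using lborel_affine[of c "0::'a"] c by simp
  also have "\<dots> = ennreal (c ^ DIM('a)) * (\<integral>\<^sup>+x. f (c *\<^sub>R x) \<partial>lborel)"
    using c by (simp add: nn_integral_density nn_integral_distr nn_integral_cmult)
  finally show ?thesis .
qed

lemma indicator_sector_scaleR:
  assumes "0 < c"
  shows "indicator (sector A c) (c *\<^sub>R x) = (indicator (sector A 1) x :: ennreal)"
  using assms by (auto simp: sector_def indicator_def sgn_scaleR)

lemma emeasure_sector:
  fixes A :: "'a::euclidean_space set"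
  assumes A: "A \<in> sets borel" "A \<subseteq> sphere 0 1" and r: "0 \<le> r"
  shows "emeasure lborel (sector A r) = ennreal (r ^ DIM('a)) * emeasure lborel (sector A 1)"
proof (cases "r = 0")
  case True
  then have "sector A r = {}"
    using A(2) by (auto simp: sector_def)
  then show ?thesis using True by simp
next
  case False
  have [measurable]: "sector A s \<in> sets borel" for s using A(1) by measurable
  have "emeasure lborel (sector A r) = (\<integral>\<^sup>+x. indicator (sector A r) x \<partial>lborel)" by simp
  also have "\<dots> = ennreal (r ^ DIM('a)) * (\<integral>\<^sup>+x. indicator (sector A r) (r *\<^sub>R x) \<partial>lborel)"
    using r False by (intro nn_integral_lborel_scaleR) auto
  finally show ?thesis using r False by (simp add: indicator_sector_scaleR)
qed

text \<open>Write \<open>norm x\<close> as the length of \<open>{0..<norm x}\<close> and exchange integrals: at level \<open>t\<close> remains the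
  shell between the sectors of radius \<open>t\<close> and \<open>1\<close>, of volume \<open>(1 - t ^ n) * V\<close> with
  \<open>n = DIM('a)\<close> and \<open>V\<close> the volume of the unit sector, and \<open>1 - 1 / (n + 1) = n / (n + 1)\<close>. This
  replaces integration in polar coordinates.\<close>

lemma nn_integral_norm_sector_1:
  fixes A :: "'a::euclidean_space set"
  assumes A: "A \<in> sets borel" "A \<subseteq> sphere 0 1"
  shows "(\<integral>\<^sup>+x. ennreal (norm x) * indicator (sector A 1) x \<partial>lborel)
    = ennreal (DIM('a) / (DIM('a) + 1)) * emeasure lborel (sector A 1)"
proof -
  have [measurable]: "sector A s \<in> sets borel" for s using A(1) by measurable
  define V where "V = emeasure lborel (sector A 1)"
  define n where "n = DIM('a)"
  obtain v where v: "V = ennreal v" "0 \<le> v"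
    using emeasure_sector_finite[of A 1] unfolding V_def
    by (metis ennreal_cases infinity_ennreal_def less_irrefl)
  have "(\<integral>\<^sup>+x. ennreal (norm x) * indicator (sector A 1) x \<partial>lborel)
      = (\<integral>\<^sup>+x. (\<integral>\<^sup>+t. indicator {0..1} t * indicator (sector A 1 - sector A t) x \<partial>lborel) \<partial>lborel)"
  proof (rule nn_integral_cong)
    fix x :: 'a
    show "ennreal (norm x) * indicator (sector A 1) x
      = (\<integral>\<^sup>+t. indicator {0..1} t * indicator (sector A 1 - sector A t) x \<partial>lborel)"
    proof (cases "x \<in> sector A 1")
      case True
      then have "(\<integral>\<^sup>+t. indicator {0..1} t * indicator (sector A 1 - sector A t) x \<partial>lborel)
          = (\<integral>\<^sup>+t. indicator {0..<norm x} t \<partial>lborel)"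
        by (intro nn_integral_cong) (auto simp: indicator_def sector_def)
      then show ?thesis using True by simp
    qed simp
  qed
  also have "\<dots> = (\<integral>\<^sup>+t. (\<integral>\<^sup>+x. indicator {0..1} t * indicator (sector A 1 - sector A t) x \<partial>lborel) \<partial>lborel)"
  proof (rule lborel_pair.Fubini')
    have "(\<lambda>(t, x). indicator {0..1} t * indicator (sector A 1 - sector A t) x :: ennreal)
       = (\<lambda>p. indicator ({0..1} \<times> sector A 1) p * indicator {p::real \<times> 'a. fst p < norm (snd p)} p)"
      by (auto simp: fun_eq_iff indicator_def sector_def)
    also have "\<dots> \<in> borel_measurable (lborel \<Otimes>\<^sub>M lborel)"
      by measurable
    finally show "(\<lambda>(t, x). indicator {0..1} t * indicator (sector A 1 - sector A t) x :: ennreal)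
       \<in> borel_measurable (lborel \<Otimes>\<^sub>M (lborel :: 'a measure))" .
  qed
  also have "\<dots> = (\<integral>\<^sup>+t. ennreal ((1 - t ^ n) * v) * indicator {0..1} t \<partial>lborel)"
  proof (rule nn_integral_cong)
    fix t :: real
    show "(\<integral>\<^sup>+x. indicator {0..1} t * indicator (sector A 1 - sector A t) x \<partial>lborel)
      = ennreal ((1 - t ^ n) * v) * indicator {0..1} t"
    proof (cases "t \<in> {0..1}")
      case True
      then have "emeasure lborel (sector A 1 - sector A t) = V - emeasure lborel (sector A t)"
        unfolding V_def using True sector_borel[OF A(1)] less_imp_neq[OF emeasure_sector_finite[of A t]]
        by (intro emeasure_Diff) (simp_all, auto simp: sector_def)
      also have "\<dots> = ennreal v - ennreal (t ^ n * v)"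
        using True emeasure_sector[OF A, of t] v
        by (simp add: n_def V_def ennreal_mult)
      also have "\<dots> = ennreal ((1 - t ^ n) * v)"
        using True v by (subst ennreal_minus) (auto simp: algebra_simps)
      finally show ?thesis using True by simp
    qed simp
  qed
  also have "\<dots> = ennreal ((1 - 1 ^ (n + 1) / (n + 1)) * v - (0 - 0 ^ (n + 1) / (n + 1)) * v)"
    by (rule nn_integral_FTC_Icc)
       (use v in \<open>auto intro!: derivative_eq_intros mult_nonneg_nonneg simp: power_le_one
        simp del: power_Suc\<close>)
  also have "(1 - 1 ^ (n + 1) / real (n + 1)) * v - (0 - 0 ^ (n + 1) / (n + 1)) * v = n / (n + 1) * v"
    by (simp add: field_simps)
  also have "ennreal (n / (n + 1) * v) = ennreal (n / (n + 1)) * V"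
    unfolding v(1) using v(2) by (intro ennreal_mult) auto
  finally show ?thesis by (simp only: V_def n_def)
qed

lemma nn_integral_norm_sector:
  fixes A :: "'a::euclidean_space set"
  assumes A: "A \<in> sets borel" "A \<subseteq> sphere 0 1" and r: "0 < r"
  shows "(\<integral>\<^sup>+x. ennreal (norm x) * indicator (sector A r) x \<partial>lborel)
    = ennreal (r ^ (DIM('a) + 1) * (DIM('a) / (DIM('a) + 1))) * emeasure lborel (sector A 1)"
proof -
  have [measurable]: "sector A s \<in> sets borel" for s using A(1) by measurable
  have "(\<integral>\<^sup>+x. ennreal (norm x) * indicator (sector A r) x \<partial>lborel)
      = ennreal (r ^ DIM('a)) * (\<integral>\<^sup>+x. ennreal (norm (r *\<^sub>R x)) * indicator (sector A r) (r *\<^sub>R x) \<partial>lborel)"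
    using r by (intro nn_integral_lborel_scaleR) auto
  also have "(\<integral>\<^sup>+x. ennreal (norm (r *\<^sub>R x)) * indicator (sector A r) (r *\<^sub>R x) \<partial>lborel)
      = (\<integral>\<^sup>+x. ennreal r * (ennreal (norm x) * indicator (sector A 1) x) \<partial>lborel)"
    using r by (intro nn_integral_cong) (simp add: indicator_sector_scaleR ennreal_mult mult.assoc)
  also have "\<dots> = ennreal r * (ennreal (DIM('a) / (DIM('a) + 1)) * emeasure lborel (sector A 1))"
    by (subst nn_integral_cmult) (simp_all add: nn_integral_norm_sector_1[OF A])
  also have "ennreal (r ^ DIM('a)) * \<dots>
      = ennreal (r ^ DIM('a)) * (ennreal r * ennreal (DIM('a) / (DIM('a) + 1))) * emeasure lborel (sector A 1)"
    by (simp only: mult.assoc)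
  also have "ennreal (r ^ DIM('a)) * (ennreal r * ennreal (DIM('a) / (DIM('a) + 1)))
      = ennreal (r ^ (DIM('a) + 1) * (DIM('a) / (DIM('a) + 1)))"
  proof -
    have "r ^ (DIM('a) + 1) * (DIM('a) / (DIM('a) + 1)) = r ^ DIM('a) * (r * (DIM('a) / (DIM('a) + 1)))"
      by simp
    then show ?thesis using r by (simp only: ennreal_mult zero_le_power less_imp_le
      mult_nonneg_nonneg divide_nonneg_nonneg of_nat_0_le_iff add_nonneg_nonneg zero_le_one)
  qed
  finally show ?thesis .
qed

text \<open>For a point at distance \<open>\<rho>\<close> from the axis, its height \<open>z\<close> determines the height
  \<open>s = z / sqrt (\<rho>\<^sup>2 + z\<^sup>2)\<close> of its direction. The inverse map is
  \<open>z = \<rho> * s / sqrt (1 - s\<^sup>2)\<close>, with derivative \<open>\<rho> / sqrt (1 - s\<^sup>2) ^ 3\<close>. The upper end point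
  \<open>sqrt (1 - \<rho>\<^sup>2)\<close>, where the line leaves the unit ball, is a fixed point, so the range of
  integration is unchanged.\<close>

lemma nn_integral_latitude_substitution:
  fixes \<rho> :: real
  assumes [measurable]: "B \<in> sets borel" and \<rho>: "0 < \<rho>" "\<rho> \<le> 1"
  shows "(\<integral>\<^sup>+z. indicator B (z / sqrt (\<rho>\<^sup>2 + z\<^sup>2)) * indicator {0..sqrt (1 - \<rho>\<^sup>2)} z \<partial>lborel)
    = (\<integral>\<^sup>+s. ennreal (\<rho> / sqrt (1 - s\<^sup>2) ^ 3) * indicator B s * indicator {0..sqrt (1 - \<rho>\<^sup>2)} s \<partial>lborel)"
proof -
  define b where "b = sqrt (1 - \<rho>\<^sup>2)"
  define g where "g s = \<rho> * s / sqrt (1 - s\<^sup>2)" for s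
  have b: "0 \<le> b" "b\<^sup>2 = 1 - \<rho>\<^sup>2"
    using \<rho> by (auto simp: b_def power_le_one)
  have s_lt: "s\<^sup>2 < 1" if "s \<in> {0..b}" for s
  proof -
    have "s\<^sup>2 \<le> b\<^sup>2" using that by (intro power_mono) auto
    moreover have "0 < \<rho>\<^sup>2" using \<rho> by simp
    ultimately show ?thesis using b by linarith
  qed
  have g_ends: "g 0 = 0" "g b = b"
    using \<rho> b by (auto simp: g_def)
  have g_inv: "g s / sqrt (\<rho>\<^sup>2 + (g s)\<^sup>2) = s" if "s \<in> {0..b}" for s
  proof -
    have pos: "0 < 1 - s\<^sup>2" using s_lt[OF that] by simp
    have "\<rho>\<^sup>2 + (g s)\<^sup>2 = \<rho>\<^sup>2 / (1 - s\<^sup>2)"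
      using pos by (simp add: g_def power_divide power_mult_distrib field_simps)
    then have "sqrt (\<rho>\<^sup>2 + (g s)\<^sup>2) = \<rho> / sqrt (1 - s\<^sup>2)"
      using \<rho> by (simp add: real_sqrt_divide)
    then show ?thesis using \<rho> pos by (simp add: g_def)
  qed
  have "(\<integral>\<^sup>+z. indicator B (z / sqrt (\<rho>\<^sup>2 + z\<^sup>2)) * indicator {0..sqrt (1 - \<rho>\<^sup>2)} z \<partial>lborel)
    = (\<integral>\<^sup>+z. ennreal (indicator B (z / sqrt (\<rho>\<^sup>2 + z\<^sup>2)) * indicator {g 0..g b} z) \<partial>lborel)"
    unfolding g_ends b_def[symmetric] by (intro nn_integral_cong) (auto simp: indicator_def)
  also have "\<dots> = (\<integral>\<^sup>+s. ennreal (indicator B (g s / sqrt (\<rho>\<^sup>2 + (g s)\<^sup>2)) * (\<rho> / sqrt (1 - s\<^sup>2) ^ 3)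
        * indicator {0..b} s) \<partial>lborel)"
  proof (subst nn_integral_substitution[where g = g and a = 0 and b = b
        and g' = "\<lambda>s. \<rho> / sqrt (1 - s\<^sup>2) ^ 3"])
    show "set_borel_measurable borel {g 0..g b} (\<lambda>z. indicat_real B (z / sqrt (\<rho>\<^sup>2 + z\<^sup>2)))"
      unfolding set_borel_measurable_def by measurable
    show "(g has_real_derivative \<rho> / sqrt (1 - s\<^sup>2) ^ 3) (at s)" if "s \<in> {0..b}" for s
    proof -
      define c where "c = sqrt (1 - s\<^sup>2)"
      have pos: "0 < 1 - s\<^sup>2" using s_lt[OF that] by simp
      then have c: "0 < c" "c\<^sup>2 = 1 - s\<^sup>2" by (auto simp: c_def)
      have "((\<lambda>s. \<rho> * s / sqrt (1 - s\<^sup>2)) has_real_derivative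
          (\<rho> * c - \<rho> * s * (- (2 * s) * (inverse c / 2))) / (c * c)) (at s)"
        using pos c by (auto intro!: derivative_eq_intros simp: c_def[symmetric])
      moreover have "(\<rho> * c - \<rho> * s * (- (2 * s) * (inverse c / 2))) / (c * c) = \<rho> * (c\<^sup>2 + s\<^sup>2) / c ^ 3"
        using c(1) by (simp add: field_simps power2_eq_square power3_eq_cube)
      ultimately show ?thesis
        using c(2) unfolding g_def[abs_def] c_def by simp
    qed
    show "continuous_on {0..b} (\<lambda>s. \<rho> / sqrt (1 - s\<^sup>2) ^ 3)"
      using s_lt by (fastforce intro!: continuous_intros)
    show "0 \<le> \<rho> / sqrt (1 - s\<^sup>2) ^ 3" if "s \<in> {0..b}" for s
      using \<rho> s_lt[OF that] by simp
  qed (use b in auto)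
  also have "\<dots> = (\<integral>\<^sup>+s. ennreal (\<rho> / sqrt (1 - s\<^sup>2) ^ 3) * indicator B s * indicator {0..b} s \<partial>lborel)"
  proof (rule nn_integral_cong)
    fix s
    show "ennreal (indicator B (g s / sqrt (\<rho>\<^sup>2 + (g s)\<^sup>2)) * (\<rho> / sqrt (1 - s\<^sup>2) ^ 3) * indicator {0..b} s)
      = ennreal (\<rho> / sqrt (1 - s\<^sup>2) ^ 3) * indicator B s * indicator {0..b} s"
      using g_inv[of s] by (cases "s \<in> {0..b}") (auto simp: indicator_def)
  qed
  finally show ?thesis by (simp only: b_def)
qed

section \<open>The hemisphere in latitude coordinates\<close>

text \<open>The image of the surface measure of the upper unit hemisphere in \<open>n + 1\<close> dimensions under
  the height coordinate \<open>s\<close> is a multiple of this measure: the parallel at height \<open>s\<close> has radius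
  \<open>sqrt (1 - s\<^sup>2)\<close>, whence the density \<open>sqrt (1 - s\<^sup>2) ^ (n - 2)\<close>. The quotient avoids a
  truncated subtraction in the exponent.\<close>

definition zonal_measure :: "nat \<Rightarrow> real measure" where
  "zonal_measure n = density lborel (\<lambda>s. ennreal (indicator {0..1} s * (sqrt (1 - s\<^sup>2) ^ n / (1 - s\<^sup>2))))"

lemma sets_zonal_measure [measurable_cong, simp]: "sets (zonal_measure n) = sets borel"
  by (simp add: zonal_measure_def)

lemma sigma_finite_zonal_measure: "sigma_finite_measure (zonal_measure n)"
  unfolding zonal_measure_def
  by (subst sigma_finite_measure.sigma_finite_iff_density_finite[OF sigma_finite_lborel]) auto

text \<open>The volume of the sector is computed by Fubini. On each vertical line the height \<open>z\<close> is
  exchanged for the height \<open>s\<close> of the direction; then \<open>s\<close> is kept fixed and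
  the points \<open>y\<close> range over the sector over \<open>A\<close> of radius \<open>sqrt (1 - s\<^sup>2)\<close>, with the integrand
  \<open>norm y\<close> coming from the substitution. The factor \<open>n / (n + 1)\<close> so obtained is exactly what
  converts the normalisation of surface measure in dimension \<open>n + 1\<close> into that in dimension
  \<open>n\<close>.\<close>

lemma emeasure_hemisphere_product_set:
  fixes A :: "'a::euclidean_space set"
  assumes A: "A \<in> sets borel" "A \<subseteq> sphere 0 1" and [measurable]: "B \<in> sets borel"
  shows "emeasure surface_measure {x \<in> sphere 0 1. 0 \<le> snd x \<and> fst x \<noteq> 0 \<and> sgn (fst x) \<in> A \<and> snd x \<in> B}
    = emeasure surface_measure A * emeasure (zonal_measure DIM('a)) B"
proof -
  note [measurable] = A(1) borel_measurable_sgn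
  have [measurable]: "sector A r \<in> sets borel" for r by (rule sector_borel[OF A(1)])
  define W where "W = {x :: 'a \<times> real. x \<in> sphere 0 1 \<and> 0 \<le> snd x \<and> fst x \<noteq> 0 \<and> sgn (fst x) \<in> A \<and> snd x \<in> B}"
  have W_borel: "W \<in> sets borel"
  proof -
    have "W = sphere 0 1 \<inter> (sgn -` A \<inter> space borel) \<times> ({0..} \<inter> B)"
      using A(2) by (auto simp: W_def)
    moreover have "sgn -` A \<inter> space borel \<in> sets (borel :: 'a measure)"
      by (rule measurable_sets[OF borel_measurable_sgn A(1)])
    moreover have "{0..} \<inter> B \<in> sets borel" by measurable
    ultimately show ?thesis by (simp only: sets.Int borel_closed closed_sphere borel_Times)
  qed
  have W_sphere: "W \<subseteq> sphere 0 1" by (auto simp: W_def)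
  define n where "n = DIM('a)"
  define V where "V = emeasure lborel (sector A 1)"
  let ?C = "\<lambda>s. ennreal (1 / sqrt (1 - s\<^sup>2) ^ 3) * indicator B s * indicator {0..1} s"
  have norm_A: "y \<noteq> 0" if "sgn y \<in> A" for y :: 'a
    using that A(2) by auto
  \<comment> \<open>The part of the sector on the vertical line through \<open>y\<close>. It is empty unless \<open>y\<close> lies in
    the unit sector over \<open>A\<close>, and its range \<open>s \<le> sqrt (1 - (norm y)\<^sup>2)\<close> is read as a condition
    \<open>norm y \<le> sqrt (1 - s\<^sup>2)\<close> on \<open>y\<close>, ready for exchanging the integrals.\<close>
  have slice: "(\<integral>\<^sup>+z. indicator (sector W 1) (y, z) \<partial>lborel)
      = (\<integral>\<^sup>+s. ?C s * (ennreal (norm y) * indicator (sector A (sqrt (1 - s\<^sup>2))) y) \<partial>lborel)" for y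
  proof (cases "sgn y \<in> A \<and> norm y \<le> 1")
    case False
    have "(y, z) \<notin> sector W 1" for z
    proof
      assume z: "(y, z) \<in> sector W 1"
      then have "sgn y \<in> A" by (auto simp: sector_def W_def sgn_prod_def sgn_scaleR split: if_splits)
      moreover have "norm y \<le> 1"
        using z norm_fst_le[of y z] by (simp add: sector_def)
      ultimately show False using False by simp
    qed
    moreover have "y \<notin> sector A (sqrt (1 - s\<^sup>2))" for s
    proof -
      have "sqrt (1 - s\<^sup>2) \<le> 1" by simp
      then show ?thesis using False by (auto simp: sector_def simp del: real_sqrt_le_1_iff)
    qed
    ultimately show ?thesis by simp
  next
    case True
    define \<rho> where "\<rho> = norm y"
    have \<rho>: "0 < \<rho>" "\<rho> \<le> 1" using True norm_A by (auto simp: \<rho>_def)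
    have "(\<integral>\<^sup>+z. indicator (sector W 1) (y, z) \<partial>lborel)
        = (\<integral>\<^sup>+z. indicator B (z / sqrt (\<rho>\<^sup>2 + z\<^sup>2)) * indicator {0..sqrt (1 - \<rho>\<^sup>2)} z \<partial>lborel)"
    proof (rule nn_integral_cong)
      fix z :: real
      have r: "0 < sqrt (\<rho>\<^sup>2 + z\<^sup>2)" using \<rho> by (simp add: add_pos_nonneg)
      have nrm: "norm (y, z) = sqrt (\<rho>\<^sup>2 + z\<^sup>2)" by (simp add: norm_Pair \<rho>_def)
      have sgn_yz: "sgn (y, z) = (y /\<^sub>R sqrt (\<rho>\<^sup>2 + z\<^sup>2), z / sqrt (\<rho>\<^sup>2 + z\<^sup>2))"
        by (simp add: sgn_div_norm nrm divide_inverse)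
      have "sgn (y /\<^sub>R sqrt (\<rho>\<^sup>2 + z\<^sup>2)) = sgn y" using r by (simp add: sgn_scaleR)
      moreover have "sgn (y, z) \<in> sphere 0 1"
        using \<rho> by (subst sgn_in_sphere_iff) (auto simp: \<rho>_def zero_prod_def)
      ultimately have "sgn (y, z) \<in> W \<longleftrightarrow> 0 \<le> z \<and> z / sqrt (\<rho>\<^sup>2 + z\<^sup>2) \<in> B"
        using r \<rho> True unfolding W_def sgn_yz by (auto simp: zero_le_divide_iff \<rho>_def)
      moreover have "norm (y, z) \<le> 1 \<longleftrightarrow> z\<^sup>2 \<le> 1 - \<rho>\<^sup>2" by (auto simp: nrm)
      moreover have "z\<^sup>2 \<le> 1 - \<rho>\<^sup>2 \<longleftrightarrow> z \<le> sqrt (1 - \<rho>\<^sup>2)" if "0 \<le> z"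
        using that real_sqrt_le_iff[of "z\<^sup>2" "1 - \<rho>\<^sup>2"] by simp
      ultimately show "indicator (sector W 1) (y, z)
          = (indicator B (z / sqrt (\<rho>\<^sup>2 + z\<^sup>2)) * indicator {0..sqrt (1 - \<rho>\<^sup>2)} z :: ennreal)"
        by (auto simp: indicator_def sector_def)
    qed
    also have "\<dots> = (\<integral>\<^sup>+s. ennreal (\<rho> / sqrt (1 - s\<^sup>2) ^ 3) * indicator B s * indicator {0..sqrt (1 - \<rho>\<^sup>2)} s \<partial>lborel)"
      by (rule nn_integral_latitude_substitution) (use \<rho> in auto)
    also have "\<dots> = (\<integral>\<^sup>+s. ?C s * (ennreal (norm y) * indicator (sector A (sqrt (1 - s\<^sup>2))) y) \<partial>lborel)"
    proof (rule nn_integral_cong)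
      fix s :: real
      have "s \<le> sqrt (1 - \<rho>\<^sup>2) \<longleftrightarrow> s \<le> 1 \<and> \<rho> \<le> sqrt (1 - s\<^sup>2)" if "0 \<le> s"
      proof -
        have "s \<le> sqrt (1 - \<rho>\<^sup>2) \<longleftrightarrow> s\<^sup>2 \<le> 1 - \<rho>\<^sup>2"
          using that real_sqrt_le_iff[of "s\<^sup>2" "1 - \<rho>\<^sup>2"] by simp
        moreover have "\<rho> \<le> sqrt (1 - s\<^sup>2) \<longleftrightarrow> \<rho>\<^sup>2 \<le> 1 - s\<^sup>2"
          using \<rho> real_sqrt_le_iff[of "\<rho>\<^sup>2" "1 - s\<^sup>2"] by simp
        moreover have "s \<le> 1" if "s\<^sup>2 \<le> 1 - \<rho>\<^sup>2"
          using that \<open>0 \<le> s\<close> by (intro power2_le_imp_le[of s 1]) (auto intro: order_trans)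
        ultimately show ?thesis by auto
      qed
      then have "indicator {0..sqrt (1 - \<rho>\<^sup>2)} s
          = (indicator {0..1} s * indicator (sector A (sqrt (1 - s\<^sup>2))) y :: ennreal)"
        using True by (auto simp: indicator_def sector_def \<rho>_def)
      moreover have "ennreal (\<rho> / sqrt (1 - s\<^sup>2) ^ 3) = ennreal (1 / sqrt (1 - s\<^sup>2) ^ 3) * ennreal \<rho>"
        if "s \<in> {0..1}"
        using that \<rho> by (subst ennreal_mult[symmetric]) (auto simp: power_le_one)
      ultimately show "ennreal (\<rho> / sqrt (1 - s\<^sup>2) ^ 3) * indicator B s * indicator {0..sqrt (1 - \<rho>\<^sup>2)} s
          = ?C s * (ennreal (norm y) * indicator (sector A (sqrt (1 - s\<^sup>2))) y)"
        by (cases "s \<in> {0..1}") (auto simp: mult_ac \<rho>_def)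
    qed
    finally show ?thesis .
  qed
  have "emeasure lborel (sector W 1) = (\<integral>\<^sup>+p. indicator (sector W 1) p \<partial>(lborel \<Otimes>\<^sub>M lborel))"
    using sector_borel[OF W_borel, of 1] by (simp add: lborel_prod)
  also have "\<dots> = (\<integral>\<^sup>+y. \<integral>\<^sup>+z. indicator (sector W 1) (y, z) \<partial>lborel \<partial>lborel)"
    using sector_borel[OF W_borel, of 1]
    by (intro lborel.nn_integral_fst[symmetric]) (simp add: lborel_prod)
  also have "\<dots> = (\<integral>\<^sup>+y. \<integral>\<^sup>+s. ?C s * (ennreal (norm y) * indicator (sector A (sqrt (1 - s\<^sup>2))) y) \<partial>lborel \<partial>lborel)"
    by (simp only: slice)
  also have "\<dots> = (\<integral>\<^sup>+s. \<integral>\<^sup>+y. ?C s * (ennreal (norm y) * indicator (sector A (sqrt (1 - s\<^sup>2))) y) \<partial>lborel \<partial>lborel)"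
  proof (rule lborel_pair.Fubini')
    have "(\<lambda>(s, y). ?C s * (ennreal (norm y) * indicator (sector A (sqrt (1 - s\<^sup>2))) y))
      = (\<lambda>p. ?C (fst p) * (ennreal (norm (snd p)) * indicator {p. norm (snd p) \<le> sqrt (1 - (fst p)\<^sup>2) \<and> sgn (snd p) \<in> A} p))"
      by (auto simp: fun_eq_iff sector_def indicator_def)
    also have "\<dots> \<in> borel_measurable (lborel \<Otimes>\<^sub>M lborel)"
      by measurable
    finally show "(\<lambda>(s, y). ?C s * (ennreal (norm y) * indicator (sector A (sqrt (1 - s\<^sup>2))) y))
        \<in> borel_measurable (lborel \<Otimes>\<^sub>M lborel)" .
  qed
  also have "\<dots> = (\<integral>\<^sup>+s. ?C s * (\<integral>\<^sup>+y. ennreal (norm y) * indicator (sector A (sqrt (1 - s\<^sup>2))) y \<partial>lborel) \<partial>lborel)"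
    by (intro nn_integral_cong nn_integral_cmult) measurable
  also have "\<dots> = (\<integral>\<^sup>+s. ennreal (n / (n + 1)) * V * (ennreal (sqrt (1 - s\<^sup>2) ^ n / (1 - s\<^sup>2)) * indicator {0..1} s * indicator B s) \<partial>lborel)"
  proof (rule nn_integral_cong)
    fix s :: real
    consider "s \<notin> {0..1}" | "s = 1" | "0 \<le> s" "s < 1" by fastforce
    then show "?C s * (\<integral>\<^sup>+y. ennreal (norm y) * indicator (sector A (sqrt (1 - s\<^sup>2))) y \<partial>lborel)
      = ennreal (n / (n + 1)) * V * (ennreal (sqrt (1 - s\<^sup>2) ^ n / (1 - s\<^sup>2)) * indicator {0..1} s * indicator B s)"
    proof cases
      case 3
      define a where "a = sqrt (1 - s\<^sup>2)"
      have a: "0 < a" "a\<^sup>2 = 1 - s\<^sup>2"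
        using 3 by (auto simp: a_def abs_square_less_1 power_le_one)
      have "1 / a ^ 3 * (a ^ (n + 1) * (n / (n + 1))) = n / (n + 1) * (a ^ n / a\<^sup>2)"
        using a(1) by (simp add: field_simps power2_eq_square power3_eq_cube)
      then have eq: "ennreal (1 / a ^ 3) * ennreal (a ^ (n + 1) * (n / (n + 1)))
          = ennreal (n / (n + 1)) * ennreal (a ^ n / a\<^sup>2)"
        using a(1) by (subst (1 2) ennreal_mult[symmetric]) auto
      have "ennreal (1 / a ^ 3) * (\<integral>\<^sup>+y. ennreal (norm y) * indicator (sector A a) y \<partial>lborel)
          = ennreal (n / (n + 1)) * ennreal (a ^ n / a\<^sup>2) * V"
        unfolding nn_integral_norm_sector[OF A a(1)] n_def[symmetric] V_def[symmetric] eq[symmetric]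
        by (simp only: mult.assoc)
      then show ?thesis
        using 3 unfolding a_def[symmetric] unfolding a(2)[symmetric] by (simp add: mult_ac)
    qed auto
  qed
  also have "\<dots> = ennreal (n / (n + 1)) * V * emeasure (zonal_measure n) B"
  proof -
    have "emeasure (zonal_measure n) B
        = (\<integral>\<^sup>+s. ennreal (sqrt (1 - s\<^sup>2) ^ n / (1 - s\<^sup>2)) * indicator {0..1} s * indicator B s \<partial>lborel)"
      unfolding zonal_measure_def
      by (subst emeasure_density) (auto intro!: nn_integral_cong simp: indicator_def)
    then show ?thesis by (simp add: nn_integral_cmult)
  qed
  finally have E: "emeasure lborel (sector W 1) = ennreal (n / (n + 1)) * V * emeasure (zonal_measure n) B" .
  have "emeasure surface_measure W = of_nat (n + 1) * (ennreal (n / (n + 1)) * V * emeasure (zonal_measure n) B)"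
    using emeasure_surface_measure_sector[OF W_borel W_sphere] by (simp add: E n_def)
  also have "\<dots> = (of_nat (n + 1) * ennreal (n / (n + 1))) * V * emeasure (zonal_measure n) B"
    by (simp only: mult.assoc)
  also have "of_nat (n + 1) * ennreal (n / (n + 1)) = of_nat n"
    by (simp only: ennreal_of_nat_eq_real_of_nat, subst ennreal_mult[symmetric]) auto
  also have "of_nat n * V = emeasure surface_measure A"
    using emeasure_surface_measure_sector[OF A] by (simp add: n_def V_def)
  finally show ?thesis by (simp add: W_def n_def)
qed

lemma measurable_surface_measure:
  "f \<in> measurable borel M \<Longrightarrow> f \<in> measurable surface_measure M"
  by (subst measurable_cong_sets[OF sets_surface_measure refl]) (rule measurable_restrict_space1)

text \<open>The hemisphere without its pole is, measure-theoretically, the product of the equatorial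
  sphere and the height interval. Two \<open>\<sigma>\<close>-finite measures agreeing on rectangles are equal, so the
  computation for product sets suffices.\<close>

lemma hemisphere_product_measure:
  defines "N \<equiv> {x :: 'a::euclidean_space \<times> real. x \<in> sphere 0 1 \<and> 0 \<le> snd x \<and> fst x \<noteq> 0}"
  defines "T \<equiv> \<lambda>x :: 'a \<times> real. (sgn (fst x), snd x)"
  shows "T \<in> measurable (restrict_space surface_measure N) (surface_measure \<Otimes>\<^sub>M zonal_measure DIM('a))" (is ?meas)
    and "surface_measure \<Otimes>\<^sub>M zonal_measure DIM('a)
      = distr (restrict_space surface_measure N) (surface_measure \<Otimes>\<^sub>M zonal_measure DIM('a)) T" (is ?eq)
proof -
  have N_sets: "N \<in> sets surface_measure"
  proof -
    have "N = sphere 0 1 \<inter> ((UNIV - {0}) \<times> {0..})"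
      by (auto simp: N_def)
    moreover have "(UNIV - {0 :: 'a}) \<times> {0 :: real..} \<in> sets borel"
      by (intro borel_Times) auto
    ultimately have "N \<in> sets borel" by simp
    then show ?thesis by (auto simp: sets_surface_measure_iff N_def)
  qed
  have space_N: "space (restrict_space surface_measure N) = N"
    using N_sets by (rule space_restrict_space2)
  have fst_meas: "(\<lambda>x. sgn (fst x)) \<in> measurable (restrict_space surface_measure N) (surface_measure :: 'a measure)"
  proof (subst measurable_cong_sets[OF refl sets_surface_measure], rule measurable_restrict_space2)
    show "(\<lambda>x. sgn (fst x)) \<in> space (restrict_space surface_measure N) \<rightarrow> sphere 0 1"
      unfolding space_N by (auto simp: N_def norm_sgn)
    show "(\<lambda>x. sgn (fst x)) \<in> borel_measurable (restrict_space surface_measure N)"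
      by (intro measurable_restrict_space1 measurable_surface_measure measurable_compose[OF _ borel_measurable_sgn]
          borel_measurable_continuous_onI continuous_on_fst[OF continuous_on_id])
  qed
  show T_meas: ?meas
    unfolding T_def
  proof (rule measurable_Pair)
    have "(\<lambda>x. snd x) \<in> measurable (borel :: ('a \<times> real) measure) (zonal_measure DIM('a))"
      by (subst measurable_cong_sets[OF refl sets_zonal_measure])
         (intro borel_measurable_continuous_onI continuous_on_snd[OF continuous_on_id])
    then show "(\<lambda>x. snd x) \<in> measurable (restrict_space surface_measure N) (zonal_measure DIM('a))"
      by (intro measurable_restrict_space1 measurable_surface_measure)
  qed (rule fst_meas)
  show ?eq
  proof (rule pair_measure_eqI)
    show "sigma_finite_measure (surface_measure :: 'a measure)"
      by (rule finite_measure.axioms, rule finite_measure_surface_measure)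
    show "sigma_finite_measure (zonal_measure DIM('a))"
      by (rule sigma_finite_zonal_measure)
    fix A :: "'a set" and B
    assume AB: "A \<in> sets surface_measure" "B \<in> sets (zonal_measure DIM('a))"
    then have A: "A \<in> sets borel" "A \<subseteq> sphere 0 1" and B: "B \<in> sets borel"
      by (simp_all add: sets_surface_measure_iff)
    let ?W = "{x :: 'a \<times> real. x \<in> sphere 0 1 \<and> 0 \<le> snd x \<and> fst x \<noteq> 0 \<and> sgn (fst x) \<in> A \<and> snd x \<in> B}"
    have "emeasure (distr (restrict_space surface_measure N) (surface_measure \<Otimes>\<^sub>M zonal_measure DIM('a)) T) (A \<times> B)
        = emeasure (restrict_space surface_measure N) (T -` (A \<times> B) \<inter> N)"
      using T_meas AB by (subst emeasure_distr) (auto simp: space_N)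
    also have "T -` (A \<times> B) \<inter> N = ?W"
      by (auto simp: T_def N_def)
    also have "emeasure (restrict_space surface_measure N) ?W = emeasure surface_measure ?W"
      by (intro emeasure_restrict_space) (simp only: sets.Int_space_eq2[OF N_sets] N_sets, auto simp: N_def)
    also have "\<dots> = emeasure surface_measure A * emeasure (zonal_measure DIM('a)) B"
      by (rule emeasure_hemisphere_product_set[OF A B])
    finally show "emeasure surface_measure A * emeasure (zonal_measure DIM('a)) B
      = emeasure (distr (restrict_space surface_measure N) (surface_measure \<Otimes>\<^sub>M zonal_measure DIM('a)) T) (A \<times> B)"
      by simp
  qed simp
qed

text \<open>The latitude coordinates leave out the poles only, where \<open>sgn (fst x) = 0\<close> is not a point
  of the sphere; the sector over them lies on a line.\<close>

lemma null_axis: "{x \<in> sphere (0 :: 'a::euclidean_space \<times> real) 1. fst x = 0} \<in> null_sets surface_measure"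
proof -
  let ?Z = "{x \<in> sphere (0 :: 'a \<times> real) 1. fst x = 0}"
  have axis_borel: "{0 :: 'a} \<times> (UNIV :: real set) \<in> sets borel" by (intro borel_Times) auto
  have "?Z = sphere 0 1 \<inter> {0} \<times> UNIV" by auto
  with axis_borel have Z: "?Z \<in> sets borel" by simp
  have null: "emeasure lborel ({0 :: 'a} \<times> (UNIV :: real set)) = 0"
    by (subst lborel_prod[symmetric], subst lborel.emeasure_pair_measure_Times) auto
  have sub: "sector ?Z 1 \<subseteq> {0} \<times> UNIV"
    by (auto simp: sector_def sgn_prod_def sgn_div_norm)
  have "emeasure lborel (sector ?Z 1) = 0"
    by (rule emeasure_eq_0[OF _ null sub]) (use axis_borel in \<open>simp only: sets_lborel\<close>)
  moreover have Z_sphere: "?Z \<subseteq> sphere 0 1" by (rule Collect_subset)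
  ultimately have "emeasure surface_measure ?Z = 0"
    by (simp only: emeasure_surface_measure_sector[OF Z Z_sphere] mult_zero_right)
  moreover have "?Z \<in> sets surface_measure"
    using Z Z_sphere by (simp only: sets_surface_measure_iff)
  ultimately show ?thesis by (rule null_setsI)
qed

text \<open>Off the null set of the poles the integral is pushed forward to the product measure, where
  Fubini's theorem separates the variables.\<close>

lemma hemisphere_integral_product:
  fixes F :: "'a::euclidean_space \<times> real \<Rightarrow> real"
  defines "H \<equiv> {x. x \<in> sphere 0 1 \<and> 0 \<le> snd x}"
  assumes F: "set_integrable surface_measure H F"
    and q: "q \<in> borel_measurable borel" and g: "g \<in> borel_measurable borel"
    and F_eq: "\<And>x. x \<in> H \<Longrightarrow> fst x \<noteq> 0 \<Longrightarrow> F x = q (sgn (fst x)) * g (snd x)"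
  shows "(LINT x:H|surface_measure. F x)
    = (LINT u|surface_measure. q u) * (LINT s|zonal_measure DIM('a). g s)"
proof -
  define N where "N = {x :: 'a \<times> real. x \<in> sphere 0 1 \<and> 0 \<le> snd x \<and> fst x \<noteq> 0}"
  define T where "T x = (sgn (fst x), snd x)" for x :: "'a \<times> real"
  define G where "G p = q (fst p) * g (snd p)" for p
  let ?P = "surface_measure \<Otimes>\<^sub>M zonal_measure DIM('a)"
  have T: "T \<in> measurable (restrict_space surface_measure N) ?P"
    and P_eq: "?P = distr (restrict_space surface_measure N) ?P T"
    using hemisphere_product_measure[where 'a = 'a] unfolding N_def T_def by auto
  interpret S: finite_measure "surface_measure :: 'a measure" by (rule finite_measure_surface_measure)
  interpret Z: sigma_finite_measure "zonal_measure DIM('a)" by (rule sigma_finite_zonal_measure)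
  interpret SZ: pair_sigma_finite "surface_measure :: 'a measure" "zonal_measure DIM('a)" ..
  have "g \<in> borel_measurable (zonal_measure DIM('a))"
    by (subst measurable_cong_sets[OF sets_zonal_measure refl]) (rule g)
  then have G: "G \<in> borel_measurable ?P"
    unfolding G_def
    by (intro borel_measurable_times measurable_compose[OF measurable_fst measurable_surface_measure[OF q]]
        measurable_compose[OF measurable_snd])
  have sets: "H \<in> sets surface_measure" "N \<in> sets surface_measure"
  proof -
    have "H = sphere 0 1 \<inter> (UNIV \<times> {0..})" "N = sphere 0 1 \<inter> ((UNIV - {0}) \<times> {0..})"
      by (auto simp: N_def H_def)
    moreover have "(UNIV - {0 :: 'a}) \<times> {0 :: real..} \<in> sets borel" "(UNIV :: 'a set) \<times> {0 :: real..} \<in> sets borel"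
      by (intro borel_Times; auto)+
    ultimately have "H \<in> sets borel" "N \<in> sets borel" by simp_all
    moreover have "H \<subseteq> sphere 0 1" "N \<subseteq> sphere 0 1" by (auto simp: N_def H_def)
    ultimately show "H \<in> sets surface_measure" "N \<in> sets surface_measure"
      by (simp_all only: sets_surface_measure_iff)
  qed
  have F_N: "F x = G (T x)" if "x \<in> N" for x
    using F_eq[of x] that by (auto simp: N_def H_def G_def T_def)
  have int_N: "set_integrable surface_measure N F"
    by (rule set_integrable_subset[OF F sets(2)]) (auto simp: N_def H_def)
  then have "integrable (restrict_space surface_measure N) F"
    by (subst integrable_restrict_space)
       (simp_all only: set_integrable_def sets.Int_space_eq2[OF sets(2)] sets(2))
  then have "integrable (restrict_space surface_measure N) (\<lambda>x. G (T x))"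
    by (rule Bochner_Integration.integrable_cong[OF refl, THEN iffD1, rotated])
       (use sets(2) in \<open>simp add: F_N\<close>)
  then have G_int: "integrable ?P G"
    by (subst P_eq, subst integrable_distr_eq[OF T G])
  have "(LINT x:H|surface_measure. F x) = (LINT x:N|surface_measure. F x)"
    unfolding set_lebesgue_integral_def
  proof (rule integral_cong_AE)
    show "(\<lambda>x. indicat_real H x *\<^sub>R F x) \<in> borel_measurable surface_measure"
      using F by (simp only: set_integrable_def borel_measurable_integrable)
    show "(\<lambda>x. indicat_real N x *\<^sub>R F x) \<in> borel_measurable surface_measure"
      using int_N by (simp only: set_integrable_def borel_measurable_integrable)
    show "AE x in surface_measure. indicat_real H x *\<^sub>R F x = indicat_real N x *\<^sub>R F x"
      by (rule AE_I'[OF null_axis]) (auto simp: N_def H_def indicator_def)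
  qed
  also have "\<dots> = (LINT x|restrict_space surface_measure N. F x)"
    by (subst integral_restrict_space)
       (simp_all only: set_lebesgue_integral_def sets.Int_space_eq2[OF sets(2)] sets(2))
  also have "\<dots> = (LINT x|restrict_space surface_measure N. G (T x))"
    by (rule Bochner_Integration.integral_cong[OF refl]) (use sets(2) in \<open>simp add: F_N\<close>)
  also have "\<dots> = integral\<^sup>L (distr (restrict_space surface_measure N) ?P T) G"
    by (rule integral_distr[OF T G, symmetric])
  also have "\<dots> = integral\<^sup>L ?P G"
    by (simp only: P_eq[symmetric])
  also have "\<dots> = (LINT u|surface_measure. LINT s|zonal_measure DIM('a). G (u, s))"
    by (rule SZ.integral_fst'[OF G_int, symmetric])
  also have "\<dots> = (LINT u|surface_measure. q u) * (LINT s|zonal_measure DIM('a). g s)"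
    by (simp add: G_def)
  finally show ?thesis .
qed

section \<open>Orthonormality on the hemisphere\<close>

text \<open>Homogeneity absorbs the factor \<open>sin \<theta> ^ index_degree k\<close> into the harmonic polynomial. Thus
  \<open>B_fun\<close> is a polynomial in the horizontal part times a polynomial in the height, which gives
  continuity at the pole.\<close>

lemma B_fun_eq_homogeneous:
  fixes Y :: "int list \<Rightarrow> real^'d \<Rightarrow> real"
  assumes Y: "spherical_harmonic_system Y" and k: "k \<in> index_set CARD('d) l"
    and x: "x \<in> hemisphere"
    and hom: "\<And>c y. P (c *\<^sub>R y) = c ^ index_degree k * P y"
    and P: "\<And>y. y \<in> sphere 0 1 \<Longrightarrow> Y k y = P y"
  shows "B_fun Y l k x
    = P (fst x) * Psi CARD('d) (l - index_degree k) (index_degree k) (snd x)"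
proof -
  have nx: "(norm (fst x))\<^sup>2 + (snd x)\<^sup>2 = 1" and nonneg: "0 \<le> snd x"
    using x by (simp_all add: hemisphere_def norm_prod_def)
  then have snd_le: "snd x \<le> 1"
    by (metis add_increasing power2_le_imp_le power_one zero_le_one order_refl zero_le_power2)
  define \<theta> where "\<theta> = arccos (snd x)"
  have \<theta>: "\<theta> \<in> {0..pi/2}" "cos \<theta> = snd x"
    using nonneg snd_le arccos_le_pi2[OF nonneg snd_le] by (auto simp: \<theta>_def arccos_lbound)
  have sin: "sin \<theta> = norm (fst x)"
    using nonneg snd_le nx by (simp add: \<theta>_def sin_arccos real_sqrt_unique)
  obtain u where u: "u \<in> sphere 0 1" "fst x = sin \<theta> *\<^sub>R u"
  proof (cases "fst x = 0")
    case True
    obtain u :: "real^'d" where "norm u = 1" using vector_choose_size[of 1] by auto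
    then show ?thesis using that[of u] True sin by simp
  next
    case False
    then show ?thesis using that[of "sgn (fst x)"] by (simp add: norm_sgn sin sgn_div_norm)
  qed
  then have "x = (sin \<theta> *\<^sub>R u, cos \<theta>)" using \<theta>(2) by (simp add: prod_eq_iff)
  then have "B_fun Y l k x = sin \<theta> ^ index_degree k
      * Psi CARD('d) (l - index_degree k) (index_degree k) (cos \<theta>) * Y k u"
    using B_fun_polar[OF Y k u(1) \<theta>(1)] by simp
  then show ?thesis using hom[of "sin \<theta>" u] P[OF u(1)] \<theta>(2) u(2) by simp
qed

text \<open>The \<open>2 * i\<close> factors \<open>sqrt (1 - s\<^sup>2)\<close> contributed by two harmonics of degree \<open>i\<close> turn the zonal
  density into the weight with exponent \<open>lam d i = i + (d - 2) / 2\<close>. The two sides agree also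
  at \<open>s = 1\<close>, where \<open>0 / 0\<close> and \<open>0 powr lam d i\<close> both evaluate to \<open>0\<close>.\<close>

lemma zonal_integral_eq_weighted_integral:
  fixes g :: "real \<Rightarrow> real"
  assumes d: "2 \<le> d" and [measurable]: "g \<in> borel_measurable borel"
  shows "(LINT s|zonal_measure d. sqrt (1 - s\<^sup>2) ^ (2 * i) * g s) = weighted_integral d i g"
proof -
  have "(LINT s|zonal_measure d. sqrt (1 - s\<^sup>2) ^ (2 * i) * g s)
      = (LBINT s. (indicator {0..1} s * (sqrt (1 - s\<^sup>2) ^ d / (1 - s\<^sup>2))) *\<^sub>R (sqrt (1 - s\<^sup>2) ^ (2 * i) * g s))"
    unfolding zonal_measure_def
    by (rule integral_density) (auto simp: indicator_def power_le_one)
  also have "\<dots> = weighted_integral d i g"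
    unfolding set_lebesgue_integral_def
  proof (intro Bochner_Integration.integral_cong refl)
    fix s :: real
    consider "s \<notin> {0..1}" | "s = 1" | "0 \<le> s" "s < 1" by fastforce
    then show "(indicator {0..1} s * (sqrt (1 - s\<^sup>2) ^ d / (1 - s\<^sup>2))) *\<^sub>R (sqrt (1 - s\<^sup>2) ^ (2 * i) * g s)
      = indicator {0..1} s *\<^sub>R (g s * (1 - s\<^sup>2) powr lam d i)"
    proof cases
      case 3
      define r where "r = 1 - s\<^sup>2"
      have r: "0 < r" using 3 by (simp add: r_def abs_square_less_1)
      have "sqrt r ^ d / r * sqrt r ^ (2 * i) = r powr (1/2 * d + 1/2 * real (2 * i) - 1)"
        using r by (simp add: powr_add powr_diff powr_powr powr_realpow[symmetric] powr_half_sqrt[symmetric])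
      also have "1/2 * d + 1/2 * real (2 * i) - 1 = lam d i"
        by (simp add: lam_def field_simps)
      finally have weight: "sqrt r ^ d / r * sqrt r ^ (2 * i) = r powr lam d i" .
      show ?thesis
        using 3 unfolding r_def[symmetric] weight[symmetric] by (simp add: mult_ac)
    qed auto
  qed
  finally show ?thesis .
qed

lemma set_integrable_surface_measure_continuous:
  fixes F :: "'a::euclidean_space \<Rightarrow> real"
  assumes H: "H \<in> sets surface_measure" and F: "continuous_on UNIV F"
  shows "set_integrable surface_measure H F"
proof -
  interpret finite_measure "surface_measure :: 'a measure" by (rule finite_measure_surface_measure)
  have "compact (F ` sphere 0 1)"
    by (intro compact_continuous_image continuous_on_subset[OF F]) auto
  then obtain b where b: "\<And>x. x \<in> sphere 0 1 \<Longrightarrow> norm (F x) \<le> b"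
    by (meson bounded_iff compact_imp_bounded imageI)
  have "integrable surface_measure F"
  proof (rule integrable_const_bound)
    show "AE x in surface_measure. norm (F x) \<le> b" using b by (intro AE_I2) simp
    show "F \<in> borel_measurable surface_measure"
      by (intro measurable_surface_measure borel_measurable_continuous_onI F)
  qed
  then show ?thesis using H unfolding set_integrable_def by (rule integrable_mult_indicator[rotated])
qed

theorem proposition2p1:
  fixes Y :: "int list \<Rightarrow> real^'d \<Rightarrow> real"
    and l l' :: nat and k k' :: "int list"
  assumes d: "CARD('d) \<ge> 2"
    and Y: "spherical_harmonic_system Y"
    and k: "k \<in> index_set CARD('d) l"
    and k': "k' \<in> index_set CARD('d) l'"
  shows "set_integrable surface_measure hemisphere (\<lambda>x. B_fun Y l k x * B_fun Y l' k' x)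
    \<and> (LINT x:hemisphere|surface_measure. B_fun Y l k x * B_fun Y l' k' x)
           = (if l = l' then 1 else 0) * (if k = k' then 1 else 0)"
proof -
  define i where "i = index_degree k"
  define i' where "i' = index_degree k'"
  define f where "f = Psi CARD('d) (l - i) i"
  define f' where "f' = Psi CARD('d) (l' - i') i'"
  have "spherical_harmonic i (Y k)" "spherical_harmonic i' (Y k')"
    using Y k k' unfolding spherical_harmonic_system_def i_def i'_def by blast+
  then obtain P P' where P: "real_polynomial_function P" "\<And>c y. P (c *\<^sub>R y) = c ^ i * P y"
      "\<And>y. y \<in> sphere 0 1 \<Longrightarrow> Y k y = P y"
    and P': "real_polynomial_function P'" "\<And>c y. P' (c *\<^sub>R y) = c ^ i' * P' y"
      "\<And>y. y \<in> sphere 0 1 \<Longrightarrow> Y k' y = P' y"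
    unfolding spherical_harmonic_def by blast
  have cont: "continuous_on A P" "continuous_on A P'" "continuous_on B f" "continuous_on B f'" for A B
    using P(1) P'(1) d unfolding f_def f'_def
    by (simp_all add: continuous_on_polymonial_function continuous_Psi real_polynomial_function_eq)
  define F where "F x = (P (fst x) * P' (fst x)) * (f (snd x) * f' (snd x))" for x :: "(real^'d) \<times> real"
  define g where "g s = sqrt (1 - s\<^sup>2) ^ (i + i') * (f s * f' s)" for s :: real
  have B_eq: "B_fun Y l k x * B_fun Y l' k' x = F x" if "x \<in> hemisphere" for x
    using B_fun_eq_homogeneous[OF Y k that, of P] B_fun_eq_homogeneous[OF Y k' that, of P'] P P'
    by (simp add: F_def f_def f'_def i_def i'_def)
  have hemisphere_eq: "hemisphere = {x :: (real^'d) \<times> real. x \<in> sphere 0 1 \<and> 0 \<le> snd x}"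
    by (auto simp: hemisphere_def)
  have "hemisphere = sphere 0 1 \<inter> ((UNIV :: (real^'d) set) \<times> {0 :: real..})"
    by (auto simp: hemisphere_def)
  moreover have "closed (sphere 0 1 \<inter> ((UNIV :: (real^'d) set) \<times> {0 :: real..}))"
    by (intro closed_Int closed_Times) auto
  ultimately have H: "(hemisphere :: ((real^'d) \<times> real) set) \<in> sets surface_measure"
    by (auto simp: sets_surface_measure_iff)
  have F_int: "set_integrable surface_measure hemisphere F"
    unfolding F_def
    by (intro set_integrable_surface_measure_continuous H continuous_intros
      continuous_on_compose2[OF cont(1) continuous_on_fst] continuous_on_compose2[OF cont(2) continuous_on_fst]
      continuous_on_compose2[OF cont(3) continuous_on_snd] continuous_on_compose2[OF cont(4) continuous_on_snd]) auto
  have "(LINT x:hemisphere|surface_measure. F x)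
      = (LINT u|surface_measure. P u * P' u) * (LINT s|zonal_measure CARD('d). g s)"
  proof -
    have "F x = (P (sgn (fst x)) * P' (sgn (fst x))) * g (snd x)" if x: "x \<in> hemisphere" for x
    proof -
      have "(norm (fst x))\<^sup>2 + (snd x)\<^sup>2 = 1"
        using x by (simp add: hemisphere_def norm_prod_def)
      then have nrm: "sqrt (1 - (snd x)\<^sup>2) = norm (fst x)"
        by (simp add: real_sqrt_unique)
      have "fst x = norm (fst x) *\<^sub>R sgn (fst x)"
        by (cases "fst x = 0") (simp_all add: sgn_div_norm)
      then have "P (fst x) = norm (fst x) ^ i * P (sgn (fst x))"
        "P' (fst x) = norm (fst x) ^ i' * P' (sgn (fst x))"
        using P(2) P'(2) by metis+
      then show ?thesis by (simp add: F_def g_def nrm power_add)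
    qed
    then show ?thesis
      using F_int unfolding hemisphere_eq
      by (subst hemisphere_integral_product[of F "\<lambda>u. P u * P' u" g])
         (auto simp: g_def intro!: borel_measurable_continuous_onI continuous_intros cont)
  qed
  also have "(LINT u|surface_measure. P u * P' u) = (LINT u|surface_measure. Y k u * Y k' u)"
    by (rule Bochner_Integration.integral_cong) (auto simp: P(3) P'(3))
  also have "\<dots> = (if k = k' then 1 else 0)"
    using Y k k' unfolding spherical_harmonic_system_def by blast
  also have "(if k = k' then 1 else 0) * (LINT s|zonal_measure CARD('d). g s)
      = (if l = l' then 1 else 0) * (if k = k' then 1 else 0)"
  proof (cases "k = k'")
    case True
    then have i': "i' = i" by (simp add: i_def i'_def)
    have "i \<le> l" "i \<le> l'"
      using k k' True by (auto simp: i_def index_set_def index_degree_def)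
    then have "l - i = l' - i \<longleftrightarrow> l = l'" by auto
    moreover have "(LINT s|zonal_measure CARD('d). g s) = (if l - i = l' - i then 1 else 0)"
    proof -
      have "(LINT s|zonal_measure CARD('d). g s) = weighted_integral CARD('d) i (\<lambda>s. f s * f' s)"
        unfolding g_def i' mult_2[symmetric]
        by (intro zonal_integral_eq_weighted_integral[OF d] borel_measurable_continuous_onI
            continuous_on_mult cont)
      then show ?thesis by (simp only: f_def f'_def i' Psi_orthonormal[OF d])
    qed
    ultimately show ?thesis using True by simp
  qed simp
  finally have "(LINT x:hemisphere|surface_measure. F x) = (if l = l' then 1 else 0) * (if k = k' then 1 else 0)" .
  moreover have "set_integrable surface_measure hemisphere (\<lambda>x. B_fun Y l k x * B_fun Y l' k' x)"
    using F_int by (subst set_integrable_cong[OF refl refl B_eq])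
  moreover have "(LINT x:hemisphere|surface_measure. B_fun Y l k x * B_fun Y l' k' x)
      = (LINT x:hemisphere|surface_measure. F x)"
    using H by (intro set_lebesgue_integral_cong) (auto simp: B_eq)
  ultimately show ?thesis by simp
qed

end
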